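(* Let $h,k:\mathbb{N}\to\mathbb{R}^{+}$ be nondecreasing functions such that $h(n)=\Omega\big((\log n)^{1/(1-\log 2)}\big)$ and $k(n)>5$ for all sufficiently large $n$. If $$(k(n)-3)\,\log h(n)\,\log\log h(n)\;\ge\;4\log 2\cdot\log n$$ for all sufficiently large $n$, then there exists a $k$-GP-free sequence $T$ with gaps of size $O(h)$.
   Context: $\mathbb{N}$ is the set of positive integers, and $\log$ is the natural logarithm. Sequences $S,T$ are increasing sequences of positive integers, identified with their sets of terms. A geometric progression of positive integers is nontrivial if its common ratio (a rational number) is not equal to $1$ (in particular it has at least two terms); its length is its number of terms. For a nondecreasing function $k$ on $\mathbb{N}$, a sequence $S$ is $k$-GP-free if for every $N\in\mathbb{N}$ the set $S\cap\{1,2,\ldots,N\}$ contains no nontrivial geometric progression of length at least $k(N)$. For a nondecreasing function $h:\mathbb{N}\to\mathbb{R}^{+}$, a sequence $S$ has gaps of size $O(h)$ if there exists a constant $C>0$ such that for every $m,N\in\mathbb{N}$ with $m\le N$, $S$ intersects the interval $[m,m+Ch(N))$. For functions $f,g$ on $\mathbb{N}$, $f=O(g)$ means there is a constant $C>0$ with $f(n)\le Cg(n)$ for all $n\in\mathbb{N}$, and $f=\Omega(g)$ means $g=O(f)$. *)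

theory Defs
  imports Complex_Main
begin

text \<open>
  The positive integers are modelled by the \<^term>\<open>n :: nat\<close> with \<open>n \<ge> 1\<close>;
  values of functions at \<open>0\<close> are never constrained or used.
\<close>

text \<open>
  A progression is given by the list of its terms, so its length is the length of the list.
  Since all terms are positive, the ratio is automatically positive, and as it differs from
  \<open>1\<close> the terms are distinct.
\<close>

definition nontrivial_gp :: "nat list \<Rightarrow> bool" where
  "nontrivial_gp xs \<longleftrightarrow> length xs \<ge> 2 \<and> (\<forall>x\<in>set xs. 0 < x) \<and>
     (\<exists>r::rat. r \<noteq> 1 \<and>
        (\<forall>i. Suc i < length xs \<longrightarrow> rat_of_nat (xs ! Suc i) = r * rat_of_nat (xs ! i)))"

definition gp_free :: "(nat \<Rightarrow> real) \<Rightarrow> nat set \<Rightarrow> bool" where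
  "gp_free k S \<longleftrightarrow>
     (\<forall>N\<ge>1. \<not> (\<exists>xs. nontrivial_gp xs \<and> set xs \<subseteq> S \<inter> {1..N} \<and> k N \<le> real (length xs)))"

definition has_gaps_O :: "(nat \<Rightarrow> real) \<Rightarrow> nat set \<Rightarrow> bool" where
  "has_gaps_O h S \<longleftrightarrow>
     (\<exists>C>0. \<forall>m N. 1 \<le> m \<and> m \<le> N \<longrightarrow>
        (\<exists>s\<in>S. real s \<in> {real m ..< real m + C * h N}))"

text \<open>
  Unlike the Landau symbols of the library, these bounds are required for all positive
  integers, not just eventually, and involve no absolute values.
\<close>

definition big_O :: "(nat \<Rightarrow> real) \<Rightarrow> (nat \<Rightarrow> real) \<Rightarrow> bool" where
  "big_O f g \<longleftrightarrow> (\<exists>C>0. \<forall>n\<ge>1. f n \<le> C * g n)"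

definition big_Omega :: "(nat \<Rightarrow> real) \<Rightarrow> (nat \<Rightarrow> real) \<Rightarrow> bool" where
  "big_Omega f g \<longleftrightarrow> big_O g f"

end

theory Submission
  imports Defs "HOL-Probability.Probability" "HOL-Real_Asymp.Real_Asymp"
begin

text \<open>
  The sequence is obtained by random deletion. Toss a fair coin for every prime power \<open>p ^ a\<close> with
  \<open>a \<ge> 1\<close>, and write \<open>v\<close> for the exponent of \<open>p\<close> in \<open>n\<close>. Delete \<open>n\<close> if, for some prime power with
  \<open>a * (k n - 2) \<le> v\<close> (call its coin active at \<open>n\<close>), the coin equals the parity of \<open>v div a\<close>.

  No long progression survives. Let \<open>P / Q\<close> be the ratio in lowest terms and, after reversing the
  progression if necessary, \<open>P > 1\<close>. Choose a prime \<open>p\<close> dividing \<open>P\<close> and let \<open>a\<close> be its exponent in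
  \<open>P\<close>. From each term to the next the exponent of \<open>p\<close> grows by \<open>a\<close>, so \<open>v div a\<close> grows by \<open>1\<close>. In a
  progression of length \<open>L \<ge> k N\<close> the last two terms both have exponent at least \<open>(L - 2) * a\<close>.
  Hence the coin of \<open>p ^ a\<close> is active at both, the two parities differ, and one of the two terms is
  deleted (\<open>gp_length_lt_of_survivors\<close>). This needs one coin per prime power only, and no
  information on the other primes of the ratio.

  Short intervals keep a survivor. Let \<open>x = min (h m) (sqrt m)\<close> and consider the numbers in
  \<open>[m, m + x)\<close> that are divisible by no fourth power of an integer \<open>d\<close> with \<open>2 \<le> d \<le> x / 4\<close>. These
  good numbers make up, up to rounding, at least half of the interval (\<open>card_good_ge\<close>). As
  \<open>k n > 5\<close>, a coin that is active at a good number \<open>n\<close> belongs to a prime \<open>p > x / 4\<close> (again up to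
  rounding) with \<open>p ^ 4\<close> dividing \<open>n\<close>. Two good numbers differ by less than \<open>p ^ 4\<close>, so their active
  coins are disjoint and their survivals are independent (\<open>active_good_disjoint\<close>). Moreover the
  number of active coins of \<open>n\<close> is at most \<open>ln n / ((k n - 2) * ln (sqrt x))\<close> (\<open>card_active_le\<close>),
  and by the inequality between \<open>h\<close> and \<open>k\<close> this is at most \<open>log\<^sub>2 (ln x)\<close>. So each good number
  survives with probability at least \<open>1 / ln x\<close>, and none survives with probability at most
  \<open>exp (- x / (4 * ln x))\<close>. By the lower bound on \<open>h\<close> this is at most \<open>1 / m\<^sup>2\<close>
  (\<open>prod_no_survivor_le\<close>). These probabilities have sum below \<open>1\<close> over all large \<open>m\<close>, so some outcome
  of the coins leaves a survivor in each of these intervals (\<open>exists_coins_with_survivors\<close>). The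
  finitely many small \<open>m\<close> are absorbed by the constant of the gap condition.
\<close>

section \<open>Independent coins\<close>

text \<open>
  The probability space of independent fair coins, one for each element of the type \<open>'c\<close>.
\<close>

definition coin_space :: "('c \<Rightarrow> bool) measure" where
  "coin_space = Pi\<^sub>M UNIV (\<lambda>_. measure_pmf (pmf_of_set UNIV))"

lemma product_prob_space_coins:
  "product_prob_space (\<lambda>_::'c. measure_pmf (pmf_of_set (UNIV :: bool set)))"
  by (intro product_prob_spaceI measure_pmf.prob_space_axioms)

lemma prob_space_coin_space: "prob_space (coin_space :: ('c \<Rightarrow> bool) measure)"
  unfolding coin_space_def by (intro prob_space_PiM measure_pmf.prob_space_axioms)

lemma space_coin_space [simp]: "space coin_space = UNIV"
  by (simp add: coin_space_def space_PiM PiE_UNIV_domain)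

lemma coin_component_measurable [measurable]:
  "(\<lambda>w. w c) \<in> measurable coin_space (count_space UNIV)"
proof -
  have "(\<lambda>w. w c) \<in> measurable coin_space (measure_pmf (pmf_of_set (UNIV :: bool set)))"
    unfolding coin_space_def by (rule measurable_component_singleton) simp
  then show ?thesis
    by (simp cong: measurable_cong_sets)
qed

lemma sets_finitely_many_coins:
  assumes "finite J"
  shows "{w. \<forall>c\<in>J. w c = g c} \<in> sets coin_space"
proof -
  have "{w. \<forall>c\<in>J. w c = g c} = {w \<in> space coin_space. \<forall>c\<in>J. w c = g c}" by simp
  also have "\<dots> \<in> sets coin_space"
    using assms by measurable
  finally show ?thesis .
qed

lemma sets_some_coin:
  assumes "finite J"
  shows "{w. \<exists>c\<in>J. w c = g c} \<in> sets coin_space"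
proof -
  have "{w. \<exists>c\<in>J. w c = g c} = {w \<in> space coin_space. \<exists>c\<in>J. w c = g c}" by simp
  also have "\<dots> \<in> sets coin_space"
    using assms by measurable
  finally show ?thesis .
qed

lemma prob_prescribed_coins:
  assumes "finite J"
  shows "measure coin_space {w. \<forall>c\<in>J. w c = g c} = (1 / 2) ^ card J"
proof -
  interpret product_prob_space "\<lambda>_. measure_pmf (pmf_of_set (UNIV :: bool set))" "UNIV :: 'a set"
    by (rule product_prob_space_coins)
  have "emeasure coin_space {w. \<forall>c\<in>J. w c = g c}
      = (\<Prod>c\<in>J. emeasure (measure_pmf (pmf_of_set (UNIV :: bool set))) {g c})"
    using emeasure_PiM_Collect[of J "\<lambda>c. {g c}"] assms
    by (simp add: coin_space_def[symmetric])
  also have "\<dots> = (\<Prod>c\<in>J. ennreal (1 / 2))"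
    by (simp add: emeasure_pmf_single)
  also have "\<dots> = ennreal ((1 / 2) ^ card J)"
    unfolding prod_constant by (rule ennreal_power) simp
  finally show ?thesis
    by (simp add: measure_def)
qed

lemma sets_no_block_survives:
  assumes "finite B" "\<And>n. n \<in> B \<Longrightarrow> finite (P n)"
  shows "{w. \<forall>n\<in>B. \<exists>c\<in>P n. w c = f n c} \<in> sets coin_space"
proof -
  have "{w. \<forall>n\<in>B. \<exists>c\<in>P n. w c = f n c} =
      {w \<in> space coin_space. \<forall>n\<in>B. w \<in> {w. \<exists>c\<in>P n. w c = f n c}}"
    by auto
  also have "\<dots> \<in> sets coin_space"
    using assms by (intro sets.sets_Collect_finite_All) (auto intro!: sets_some_coin)
  finally show ?thesis .
qed

text \<open>
  Think of \<open>P n\<close> as the block of coins relevant to \<open>n\<close>, and of \<open>w c = f n c\<close> as the coin \<open>c\<close>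
  killing \<open>n\<close>. For disjoint blocks the events \<open>n is killed\<close> are independent. The extra prescribed
  coins \<open>J\<close> make this provable by induction on \<open>B\<close>: the event that the block of \<open>b\<close> kills is the
  complement of the event that all coins of the block have the other value, and the latter is
  again a prescription of coins.
\<close>

lemma prob_no_block_survives:
  assumes "finite J" "finite B" "\<And>n. n \<in> B \<Longrightarrow> finite (P n)"
    and "\<And>n. n \<in> B \<Longrightarrow> P n \<inter> J = {}" "disjoint_family_on P B"
  shows "measure coin_space {w. (\<forall>c\<in>J. w c = g c) \<and> (\<forall>n\<in>B. \<exists>c\<in>P n. w c = f n c)}
      = (1 / 2) ^ card J * (\<Prod>n\<in>B. 1 - (1 / 2) ^ card (P n))"
  using assms(2,1,3-)
proof (induction B arbitrary: J g rule: finite_induct)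
  case empty
  then show ?case by (simp add: prob_prescribed_coins)
next
  case (insert b B)
  interpret prob_space "coin_space :: ('a \<Rightarrow> bool) measure"
    by (rule prob_space_coin_space)
  define E where "E = {w. (\<forall>c\<in>J. w c = g c) \<and> (\<forall>n\<in>B. \<exists>c\<in>P n. w c = f n c)}"
  \<comment> \<open>The prescription of \<open>J\<close>, extended to the block of \<open>b\<close> so that no coin of it kills.\<close>
  define g' where "g' = (\<lambda>c. if c \<in> J then g c else \<not> f b c)"
  define E' where "E' = {w. (\<forall>c\<in>J \<union> P b. w c = g' c) \<and> (\<forall>n\<in>B. \<exists>c\<in>P n. w c = f n c)}"
  have disj: "disjoint_family_on P B" and PB: "n \<in> B \<Longrightarrow> P n \<inter> P b = {}" for n
    using insert.prems(4) insert.hyps by (auto simp: disjoint_family_on_def)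
  have sets: "E \<in> sets coin_space" "E' \<in> sets coin_space"
    unfolding E_def E'_def Collect_conj_eq
    using insert.hyps(1) insert.prems(1,2)
    by (auto intro!: sets.Int sets_finitely_many_coins sets_no_block_survives)
  have "{w. (\<forall>c\<in>J. w c = g c) \<and> (\<forall>n\<in>insert b B. \<exists>c\<in>P n. w c = f n c)} = E - E'"
    using insert.prems(3)[of b] by (auto simp: E_def E'_def g'_def)
  moreover have "E' \<subseteq> E"
    by (auto simp: E_def E'_def g'_def)
  ultimately have "measure coin_space
        {w. (\<forall>c\<in>J. w c = g c) \<and> (\<forall>n\<in>insert b B. \<exists>c\<in>P n. w c = f n c)}
      = measure coin_space E - measure coin_space E'"
    using sets by (simp add: finite_measure_Diff)
  also have "measure coin_space E = (1 / 2) ^ card J * (\<Prod>n\<in>B. 1 - (1 / 2) ^ card (P n))"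
    unfolding E_def using insert.prems disj by (intro insert.IH) auto
  also have "measure coin_space E'
      = (1 / 2) ^ card (J \<union> P b) * (\<Prod>n\<in>B. 1 - (1 / 2) ^ card (P n))"
    unfolding E'_def using insert.prems disj by (intro insert.IH) (auto simp: Int_Un_distrib PB)
  also have "card (J \<union> P b) = card J + card (P b)"
    using insert.prems by (intro card_Un_disjoint) auto
  finally show ?case
    using insert.hyps by (simp add: power_add algebra_simps)
qed

text \<open>
  The union bound: if the probabilities that nothing in \<open>G m\<close> survives have sum below \<open>1\<close>, then
  some outcome of the coins leaves a survivor in every \<open>G m\<close>.
\<close>

lemma exists_coins_with_survivors:
  fixes P :: "'i \<Rightarrow> 'c set" and f :: "'i \<Rightarrow> 'c \<Rightarrow> bool" and G :: "nat \<Rightarrow> 'i set"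
  assumes "\<And>m. finite (G m)" "\<And>m n. n \<in> G m \<Longrightarrow> finite (P n)"
    and "\<And>m. disjoint_family_on P (G m)"
    and le: "\<And>m. (\<Prod>n\<in>G m. 1 - (1 / 2) ^ card (P n)) \<le> (b m :: real)"
    and "summable b" "(\<Sum>m. b m) < 1"
  shows "\<exists>w. \<forall>m. \<exists>n\<in>G m. \<forall>c\<in>P n. w c \<noteq> f n c"
proof -
  interpret prob_space "coin_space :: ('c \<Rightarrow> bool) measure"
    by (rule prob_space_coin_space)
  define E where "E m = {w. \<forall>n\<in>G m. \<exists>c\<in>P n. w c = f n c}" for m
  have sets: "range E \<subseteq> sets coin_space"
    unfolding E_def using assms(1,2) by (auto intro!: sets_no_block_survives)
  have prob_E: "prob (E m) \<le> b m" for m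
    using prob_no_block_survives[of "{}" "G m" P "\<lambda>_. False" f] assms(1-3) le[of m]
    by (simp add: E_def)
  have summable: "summable (\<lambda>m. prob (E m))"
    by (rule summable_comparison_test'[OF \<open>summable b\<close>, of 0]) (simp add: prob_E)
  have "prob (\<Union>m. E m) \<le> (\<Sum>m. prob (E m))"
    using sets summable by (rule finite_measure_subadditive_countably)
  also have "\<dots> \<le> (\<Sum>m. b m)"
    using summable \<open>summable b\<close> by (intro suminf_le prob_E)
  finally have "prob (\<Union>m. E m) < 1"
    using assms(6) by simp
  then have "(\<Union>m. E m) \<noteq> space coin_space"
    using prob_space by auto
  then obtain w where "\<And>m. w \<notin> E m"
    by auto
  then show ?thesis
    by (auto simp: E_def)
qed

section \<open>Prime exponents along a geometric progression\<close>

text \<open>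
  For a prime \<open>p\<close> dividing the numerator of the ratio \<open>P / Q\<close>, the exponents of \<open>p\<close> in the terms form
  an arithmetic progression with difference \<open>a\<close>, so the last two terms have large exponents.
\<close>

lemma multiplicity_along_progression:
  fixes f :: "nat \<Rightarrow> nat"
  assumes "1 < P" "coprime P Q" "0 < Q" "2 \<le> L"
    and pos: "\<And>i. i < L \<Longrightarrow> 0 < f i"
    and step: "\<And>i. Suc i < L \<Longrightarrow> Q * f (Suc i) = P * f i"
  shows "\<exists>p a i j. prime p \<and> 1 \<le> a \<and> i < L \<and> j < L \<and>
    multiplicity p (f j) = multiplicity p (f i) + a \<and> (L - 2) * a \<le> multiplicity p (f i)"
proof -
  obtain p where p: "prime p" "p dvd P"
    using \<open>1 < P\<close> prime_factor_nat[of P] by auto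
  define a where "a = multiplicity p P"
  have a: "1 \<le> a"
    using p \<open>1 < P\<close> by (simp add: a_def Suc_le_eq prime_multiplicity_gt_zero_iff)
  have "\<not> p dvd Q"
    using p \<open>coprime P Q\<close> by (meson coprime_common_divisor not_prime_unit)
  then have Q: "multiplicity p Q = 0"
    by (simp add: not_dvd_imp_multiplicity_0)
  have succ: "multiplicity p (f (Suc i)) = multiplicity p (f i) + a" if "Suc i < L" for i
  proof -
    have "multiplicity p (Q * f (Suc i)) = multiplicity p Q + multiplicity p (f (Suc i))"
      using p \<open>0 < Q\<close> pos[of "Suc i"] that by (intro prime_elem_multiplicity_mult_distrib) auto
    moreover have "multiplicity p (P * f i) = multiplicity p P + multiplicity p (f i)"
      using p \<open>1 < P\<close> pos[of i] that by (intro prime_elem_multiplicity_mult_distrib) auto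
    ultimately show ?thesis
      using step[OF that] Q by (simp add: a_def)
  qed
  have "i * a \<le> multiplicity p (f i)" if "i < L" for i
    using that
  proof (induction i)
    case (Suc i)
    then show ?case using succ[of i] by simp
  qed simp
  from this[of "L - 2"] succ[of "L - 2"] \<open>2 \<le> L\<close>
  have "multiplicity p (f (L - 1)) = multiplicity p (f (L - 2)) + a"
    "(L - 2) * a \<le> multiplicity p (f (L - 2))"
    by (simp_all add: Suc_diff_le numeral_2_eq_2 Suc_diff_Suc)
  then show ?thesis
    using p a \<open>2 \<le> L\<close>
    by (intro exI[of _ p] exI[of _ a] exI[of _ "L - 2"] exI[of _ "L - 1"]) auto
qed

text \<open>
  In a nontrivial progression either the numerator or the denominator of the ratio exceeds \<open>1\<close>. The
  second case is the first one for the reversed progression, so that \<open>u\<close> and \<open>v\<close> are the last two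
  or the first two terms.
\<close>

lemma nontrivial_gp_prime_step:
  assumes "nontrivial_gp xs"
  shows "\<exists>p a u v. prime p \<and> 1 \<le> a \<and> u \<in> set xs \<and> v \<in> set xs \<and>
    multiplicity p v = multiplicity p u + a \<and> (length xs - 2) * a \<le> multiplicity p u"
proof -
  define L where "L = length xs"
  obtain r :: rat where L: "2 \<le> L" and pos: "\<And>i. i < L \<Longrightarrow> 0 < xs ! i" and "r \<noteq> 1"
    and r: "\<And>i. Suc i < L \<Longrightarrow> rat_of_nat (xs ! Suc i) = r * rat_of_nat (xs ! i)"
    using assms by (auto simp: nontrivial_gp_def L_def)
  have "0 < r * rat_of_nat (xs ! 0)"
    using r[of 0] pos[of 1] L by simp
  then have "0 < r"
    using pos[of 0] L by (simp add: zero_less_mult_iff)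
  obtain P' Q' where PQ': "quotient_of r = (P', Q')"
    by (cases "quotient_of r")
  have Q': "0 < Q'" and r_eq: "r = of_int P' / of_int Q'" and coprime': "coprime P' Q'"
    using PQ' by (auto simp: quotient_of_denom_pos quotient_of_div quotient_of_coprime)
  have "0 < P'"
    using \<open>0 < r\<close> Q' by (simp add: r_eq zero_less_divide_iff)
  define P Q where "P = nat P'" and "Q = nat Q'"
  have PQ: "0 < P" "0 < Q" "coprime P Q" "r = of_nat P / of_nat Q"
    using \<open>0 < P'\<close> Q' coprime' by (simp_all add: P_def Q_def r_eq flip: coprime_int_iff)
  have step: "Q * xs ! Suc i = P * xs ! i" if "Suc i < L" for i
  proof -
    have "rat_of_nat (Q * xs ! Suc i) = rat_of_nat (P * xs ! i)"
      using r[OF that] PQ by simp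
    then show ?thesis by (simp only: of_nat_eq_iff)
  qed
  have "P \<noteq> 1 \<or> Q \<noteq> 1"
    using \<open>r \<noteq> 1\<close> PQ by auto
  then consider "1 < P" | "1 < Q"
    using PQ by linarith
  then have "\<exists>p a i j. prime p \<and> 1 \<le> a \<and> i < L \<and> j < L \<and>
    multiplicity p (xs ! j) = multiplicity p (xs ! i) + a \<and> (L - 2) * a \<le> multiplicity p (xs ! i)"
  proof cases
    case 1
    then show ?thesis
      using multiplicity_along_progression[of P Q L "\<lambda>i. xs ! i"] PQ L pos step by blast
  next
    case 2
    have "P * xs ! (L - 1 - Suc i) = Q * xs ! (L - 1 - i)" if "Suc i < L" for i
      using step[of "L - 1 - Suc i"] that by (simp add: Suc_diff_Suc)
    then obtain p a i j where *: "prime p" "1 \<le> a" "i < L" "j < L"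
      "multiplicity p (xs ! (L - 1 - j)) = multiplicity p (xs ! (L - 1 - i)) + a"
      "(L - 2) * a \<le> multiplicity p (xs ! (L - 1 - i))"
      using multiplicity_along_progression[of Q P L "\<lambda>i. xs ! (L - 1 - i)"] 2 PQ L pos
      by (auto simp: coprime_commute)
    then show ?thesis
      by (intro exI[of _ p] exI[of _ a] exI[of _ "L - 1 - i"] exI[of _ "L - 1 - j"]) auto
  qed
  then show ?thesis
    unfolding L_def by (metis nth_mem)
qed

section \<open>Active prime powers\<close>

text \<open>
  The coins are indexed by pairs \<open>(p, a)\<close>, standing for the prime power \<open>p ^ a\<close>. The coin \<open>(p, a)\<close>
  is active at \<open>n\<close> for the length \<open>\<kappa>\<close> if \<open>n\<close> is divisible by the \<open>(\<kappa> - 2)\<close>-th power of \<open>p ^ a\<close>. As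
  \<open>\<kappa>\<close> is real, this is expressed through the exponent of \<open>p\<close> in \<open>n\<close>.
\<close>

definition active :: "real \<Rightarrow> nat \<Rightarrow> (nat \<times> nat) set" where
  "active \<kappa> n = {(p, a). prime p \<and> 1 \<le> a \<and> real a * (\<kappa> - 2) \<le> real (multiplicity p n)}"

lemma four_le_multiplicity_of_active:
  assumes "(p, a) \<in> active \<kappa> n" "5 < \<kappa>"
  shows "prime p" "4 \<le> multiplicity p n"
proof -
  from assms have a: "1 \<le> a" "real a * (\<kappa> - 2) \<le> real (multiplicity p n)" and p: "prime p"
    by (auto simp: active_def)
  have "3 < 1 * (\<kappa> - 2)" using \<open>5 < \<kappa>\<close> by simp
  also have "\<dots> \<le> real a * (\<kappa> - 2)"
    using a \<open>5 < \<kappa>\<close> by (intro mult_right_mono) auto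
  also note a(2)
  finally show "4 \<le> multiplicity p n" by simp
  show "prime p" by fact
qed

lemma power4_dvd_of_active:
  assumes "(p, a) \<in> active \<kappa> n" "5 < \<kappa>"
  shows "p ^ 4 dvd n"
  using four_le_multiplicity_of_active[OF assms] multiplicity_dvd' by blast

lemma finite_active:
  assumes "0 < n" "5 < \<kappa>"
  shows "finite (active \<kappa> n)"
proof (rule finite_subset)
  show "active \<kappa> n \<subseteq> {..n} \<times> {..n}"
  proof safe
    fix p a assume pa: "(p, a) \<in> active \<kappa> n"
    have p: "prime p" "p ^ 4 dvd n"
      using four_le_multiplicity_of_active[OF pa \<open>5 < \<kappa>\<close>] power4_dvd_of_active[OF pa \<open>5 < \<kappa>\<close>]
      by auto
    then have "p dvd n" by (meson dvd_power dvd_trans zero_less_numeral)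
    then show "p \<le> n" using \<open>0 < n\<close> by (simp add: dvd_imp_le)
    have "real a * 1 \<le> real a * (\<kappa> - 2)"
      using \<open>5 < \<kappa>\<close> by (intro mult_left_mono) auto
    also have "\<dots> \<le> real (multiplicity p n)" using pa by (simp add: active_def)
    finally have "a \<le> multiplicity p n" by simp
    also have "\<dots> < 2 ^ multiplicity p n" by simp
    also have "\<dots> \<le> p ^ multiplicity p n"
      using p by (intro power_mono) (auto dest: prime_ge_2_nat)
    also have "\<dots> \<le> n"
      using \<open>0 < n\<close> by (simp add: dvd_imp_le multiplicity_dvd)
    finally show "a \<le> n" by simp
  qed
qed simp

text \<open>
  For each prime \<open>p\<close> the number of active \<open>a\<close> is at most \<open>v / (\<kappa> - 2)\<close>, where \<open>v\<close> is the exponent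
  of \<open>p\<close> in \<open>n\<close>. So each active coin accounts for a factor of at least \<open>y powr (\<kappa> - 2)\<close> of \<open>n\<close>.
\<close>

lemma card_active_le:
  assumes "0 < n" "5 < \<kappa>" "1 \<le> y" and y: "\<And>p a. (p, a) \<in> active \<kappa> n \<Longrightarrow> y \<le> real p"
  shows "real (card (active \<kappa> n)) * (\<kappa> - 2) * ln y \<le> ln (real n)"
proof -
  define A where "A p = {a. (p, a) \<in> active \<kappa> n}" for p
  define F where "F = fst ` active \<kappa> n"
  have fin: "finite F" using finite_active assms by (simp add: F_def)
  have F: "prime p" "y \<le> real p" if "p \<in> F" for p
    using that y by (auto simp: F_def active_def)
  have F_sub: "F \<subseteq> prime_factors n"
  proof
    fix p assume "p \<in> F"
    then obtain a where "(p, a) \<in> active \<kappa> n" by (auto simp: F_def)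
    from four_le_multiplicity_of_active[OF this \<open>5 < \<kappa>\<close>] show "p \<in> prime_factors n"
      by (simp add: prime_factors_multiplicity)
  qed
  have A_le: "finite (A p)" "real (card (A p)) * (\<kappa> - 2) \<le> real (multiplicity p n)" for p
  proof -
    define b where "b = real (multiplicity p n) / (\<kappa> - 2)"
    have "0 \<le> b" using \<open>5 < \<kappa>\<close> by (simp add: b_def)
    have sub: "A p \<subseteq> {1..nat \<lfloor>b\<rfloor>}"
      using \<open>5 < \<kappa>\<close> by (auto simp: A_def active_def b_def field_simps le_nat_floor)
    then show "finite (A p)" using finite_subset by blast
    have "card (A p) \<le> nat \<lfloor>b\<rfloor>" using card_mono[OF _ sub] by simp
    then have "real (card (A p)) \<le> b"
      using \<open>0 \<le> b\<close> by linarith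
    then show "real (card (A p)) * (\<kappa> - 2) \<le> real (multiplicity p n)"
      using \<open>5 < \<kappa>\<close> by (simp add: b_def field_simps)
  qed
  have "active \<kappa> n = Sigma F A"
    by (force simp: F_def A_def)
  then have "card (active \<kappa> n) = (\<Sum>p\<in>F. card (A p))"
    using fin A_le by simp
  then have "real (card (active \<kappa> n)) * (\<kappa> - 2) * ln y
      = (\<Sum>p\<in>F. real (card (A p)) * (\<kappa> - 2) * ln y)"
    by (simp add: sum_distrib_right)
  also have "\<dots> \<le> (\<Sum>p\<in>F. real (multiplicity p n) * ln (real p))"
  proof (intro sum_mono mult_mono)
    fix p assume "p \<in> F"
    show "ln y \<le> ln (real p)" using F[OF \<open>p \<in> F\<close>] \<open>1 \<le> y\<close> by simp
  qed (use A_le \<open>1 \<le> y\<close> in auto)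
  also have "\<dots> = (\<Sum>p\<in>F. ln (real p ^ multiplicity p n))"
    using F by (intro sum.cong) (auto simp: ln_realpow prime_gt_0_nat)
  also have "\<dots> = ln (\<Prod>p\<in>F. real p ^ multiplicity p n)"
    using F fin by (intro ln_prod[symmetric]) (auto simp: prime_gt_0_nat)
  also have "\<dots> = ln (real (\<Prod>p\<in>F. p ^ multiplicity p n))"
    by simp
  also have "(\<Prod>p\<in>F. p ^ multiplicity p n) dvd (\<Prod>p\<in>prime_factors n. p ^ multiplicity p n)"
    using F_sub by (intro prod_dvd_prod_subset) auto
  then have "(\<Prod>p\<in>F. p ^ multiplicity p n) dvd n"
    using \<open>0 < n\<close> by (simp add: prime_factorization_nat[symmetric])
  then have "ln (real (\<Prod>p\<in>F. p ^ multiplicity p n)) \<le> ln (real n)"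
    using \<open>0 < n\<close> F fin
    by (subst ln_le_cancel_iff) (auto intro!: dvd_imp_le prod_pos simp: prime_gt_0_nat simp del: of_nat_prod)
  finally show ?thesis .
qed

section \<open>Numbers without fourth powers of small primes\<close>

text \<open>
  The elements of the interval of length \<open>H\<close> starting at \<open>m\<close> that are not divisible by the fourth
  power of any \<open>d\<close> with \<open>2 \<le> d \<le> H / 4\<close>. Fourth powers suit lengths \<open>\<kappa> > 5\<close>: if \<open>(p, a)\<close> is active
  for such a length, then the exponent of \<open>p\<close> is greater than \<open>3\<close>.
\<close>

definition good :: "nat \<Rightarrow> nat \<Rightarrow> nat set" where
  "good m H = {n \<in> {m..<m + H}. \<forall>d\<in>{2..H div 4}. \<not> d ^ 4 dvd n}"

lemma card_multiples_le:
  assumes "0 < d"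
  shows "real (card {n \<in> {m..<m + H}. d dvd n}) \<le> real H / real d + 1"
proof (cases "H = 0")
  case False
  define A B where "A = real m / real d" and "B = real (m + H - 1) / real d"
  have "inj_on (\<lambda>n. int (n div d)) {n \<in> {m..<m + H}. d dvd n}"
    by (auto intro!: inj_onI elim!: dvdE)
  moreover have "(\<lambda>n. int (n div d)) ` {n \<in> {m..<m + H}. d dvd n} \<subseteq> {\<lceil>A\<rceil>..\<lfloor>B\<rfloor>}"
  proof safe
    fix n assume n: "n \<in> {m..<m + H}" "d dvd n"
    then have "real (n div d) = real n / real d" by (rule_tac real_of_nat_div)
    then have "A \<le> real (n div d)" "real (n div d) \<le> B"
      using n assms by (simp_all add: A_def B_def divide_right_mono)
    then show "int (n div d) \<in> {\<lceil>A\<rceil>..\<lfloor>B\<rfloor>}"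
      by (simp add: ceiling_le_iff le_floor_iff)
  qed
  ultimately have "card {n \<in> {m..<m + H}. d dvd n} \<le> card {\<lceil>A\<rceil>..\<lfloor>B\<rfloor>}"
    by (intro card_inj_on_le) auto
  then have "real (card {n \<in> {m..<m + H}. d dvd n}) \<le> max 0 (B - A + 1)"
    by simp linarith
  also have "B - A = real (H - 1) / real d"
    using False by (simp add: A_def B_def diff_divide_distrib[symmetric])
  also have "max 0 (real (H - 1) / real d + 1) \<le> real H / real d + 1"
    using assms by (simp add: divide_right_mono add_nonneg_pos)
  finally show ?thesis .
qed simp

lemma sum_inverse_fourth_powers_le: "(\<Sum>d\<in>{2..y}. 1 / real d ^ 4) \<le> 1 / 4"
proof (cases "y = 0")
  case False
  then obtain z where z: "y = Suc z" using not0_implies_Suc by blast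
  have "(\<Sum>d\<in>{2..Suc z}. 1 / real d ^ 4) \<le> (1 - 1 / real (Suc z)) / 4" 
  proof (induction z)
    case (Suc z)
    define t where "t = real z + 1"
    have "t \<ge> 1" by (simp add: t_def)
    \<comment> \<open>The fourth powers are compared with a telescoping sum.\<close>
    have "1 / (t + 1) ^ 4 \<le> 1 / (4 * (t * (t + 1)))"
    proof (rule divide_left_mono)
      have "4 * (t * (t + 1)) \<le> (t + 1) ^ 2 * (t + 1) ^ 2"
      proof (rule mult_mono)
        show "4 \<le> (t + 1)\<^sup>2" using power_mono[of 2 "t + 1" 2] \<open>t \<ge> 1\<close> by simp
        show "t * (t + 1) \<le> (t + 1)\<^sup>2" using \<open>t \<ge> 1\<close> by (simp add: power2_eq_square)
      qed (use \<open>t \<ge> 1\<close> in auto)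
      then show "4 * (t * (t + 1)) \<le> (t + 1) ^ 4" by (simp add: power_add[symmetric])
    qed (use \<open>t \<ge> 1\<close> in auto)
    also have "\<dots> = (1 / t - 1 / (t + 1)) / 4"
      using \<open>t \<ge> 1\<close> by (simp add: field_simps)
    finally have "1 / real (Suc (Suc z)) ^ 4 \<le> (1 / real (Suc z) - 1 / real (Suc (Suc z))) / 4"
      by (simp add: t_def add_ac)
    moreover have "(\<Sum>d\<in>{2..Suc (Suc z)}. 1 / real d ^ 4)
        = (\<Sum>d\<in>{2..Suc z}. 1 / real d ^ 4) + 1 / real (Suc (Suc z)) ^ 4"
      by (subst sum.nat_ivl_Suc') simp_all
    moreover have "s' \<le> (1 - c) / 4" if "u \<le> (b - c) / 4" "s' = s + u" "s \<le> (1 - b) / 4"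
      for s s' u b c :: real
      using that by (simp add: field_simps)
    ultimately show ?case
      using Suc by blast
  qed simp
  also have "\<dots> \<le> 1 / 4" by simp
  finally show ?thesis by (simp only: z)
qed simp

lemma card_good_ge: "real H / 2 \<le> real (card (good m H))"
proof -
  define y where "y = H div 4"
  define M where "M d = {n \<in> {m..<m + H}. d ^ 4 dvd n}" for d
  have "{m..<m + H} = good m H \<union> (\<Union>d\<in>{2..y}. M d)"
    by (auto simp: good_def M_def y_def)
  then have "H = card (good m H \<union> (\<Union>d\<in>{2..y}. M d))"
    by (metis card_atLeastLessThan diff_add_inverse)
  also have "\<dots> \<le> card (good m H) + (\<Sum>d\<in>{2..y}. card (M d))"
    by (intro order_trans[OF card_Un_le] add_left_mono card_UN_le) simp
  finally have "real H \<le> real (card (good m H)) + (\<Sum>d\<in>{2..y}. real (card (M d)))"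
    by (metis of_nat_add of_nat_le_iff of_nat_sum)
  also have "(\<Sum>d\<in>{2..y}. real (card (M d))) \<le> (\<Sum>d\<in>{2..y}. real H * (1 / real d ^ 4) + 1)"
  proof (rule sum_mono)
    fix d assume "d \<in> {2..y}"
    then show "real (card (M d)) \<le> real H * (1 / real d ^ 4) + 1"
      using card_multiples_le[of "d ^ 4" m H] by (simp add: M_def)
  qed
  also have "\<dots> = real H * (\<Sum>d\<in>{2..y}. 1 / real d ^ 4) + real (card {2..y})"
    by (simp add: sum.distrib sum_distrib_left)
  also have "\<dots> \<le> real H * (1 / 4) + real H / 4"
  proof (intro add_mono mult_left_mono sum_inverse_fourth_powers_le)
    have "card {2..y} \<le> y" by simp
    also have "real y \<le> real H / 4" unfolding y_def by linarith
    finally show "real (card {2..y}) \<le> real H / 4" by simp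
  qed simp
  finally show ?thesis by simp
qed

lemma active_good_gt:
  assumes "n \<in> good m H" "5 < \<kappa>" "(p, a) \<in> active \<kappa> n"
  shows "H < 4 * p"
proof -
  have "prime p" "p ^ 4 dvd n"
    using four_le_multiplicity_of_active power4_dvd_of_active assms by auto
  then have "\<not> p \<le> H div 4"
    using assms(1) prime_ge_2_nat by (auto simp: good_def)
  then show ?thesis by linarith
qed

text \<open>
  A common active coin of two good numbers would give a prime \<open>p\<close> with \<open>H < 4 * p\<close> whose fourth power
  divides their difference, which is less than \<open>H\<close>.
\<close>

lemma active_good_disjoint:
  assumes "\<And>n. n \<in> good m H \<Longrightarrow> 5 < k n"
  shows "disjoint_family_on (\<lambda>n. active (k n) n) (good m H)"
proof -
  have False if n: "n \<in> good m H" "n' \<in> good m H" "n < n'"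
    and pa: "(p, a) \<in> active (k n) n" "(p, a) \<in> active (k n') n'" for n n' p a
  proof -
    have "p ^ 4 dvd n'" "p ^ 4 dvd n"
      using power4_dvd_of_active n pa assms by blast+
    then have "p ^ 4 dvd n' - n" by (rule dvd_diff_nat)
    then have "p ^ 4 \<le> n' - n"
      using n by (intro dvd_imp_le) auto
    also have "\<dots> < H" using n by (auto simp: good_def)
    also have "\<dots> < 4 * p" using active_good_gt n pa assms by blast
    finally have "p ^ 4 < 4 * p" .
    moreover have "2 \<le> p"
      using four_le_multiplicity_of_active n pa assms prime_ge_2_nat by blast
    then have "2 ^ 3 * p \<le> p ^ 3 * p" by (intro mult_right_mono power_mono) auto
    ultimately show False by (simp add: power_Suc2[symmetric])
  qed
  then show ?thesis
    unfolding disjoint_family_on_def by (metis disjoint_iff_not_equal nat_neq_iff surj_pair)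
qed

section \<open>Survivors contain no long progressions\<close>

text \<open>
  The numbers \<open>n\<close> that are not deleted, where a coin \<open>(p, a)\<close> that is active for the length \<open>k n\<close>
  deletes \<open>n\<close> if its value \<open>w (p, a)\<close> is the parity of \<open>v div a\<close>, for \<open>v\<close> the exponent of \<open>p\<close> in \<open>n\<close>.
  Note that \<open>v div a\<close> is the exponent of the largest power of \<open>p ^ a\<close> that divides \<open>n\<close>.
\<close>

definition survivors :: "(nat \<Rightarrow> real) \<Rightarrow> (nat \<times> nat \<Rightarrow> bool) \<Rightarrow> nat set" where
  "survivors k w =
     {n. \<forall>(p, a)\<in>active (k n) n. w (p, a) \<noteq> odd (multiplicity p n div a)}"

lemma gp_length_lt_of_survivors:
  assumes "nontrivial_gp xs" "set xs \<subseteq> survivors k w"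
    and k: "\<And>n. n \<in> set xs \<Longrightarrow> k n \<le> \<kappa>"
  shows "real (length xs) < \<kappa>"
proof (rule ccontr)
  assume "\<not> real (length xs) < \<kappa>"
  then have len: "\<kappa> \<le> real (length xs)" by simp
  obtain p a u v where *: "prime p" "1 \<le> a" "u \<in> set xs" "v \<in> set xs"
    "multiplicity p v = multiplicity p u + a" "(length xs - 2) * a \<le> multiplicity p u"
    using nontrivial_gp_prime_step[OF assms(1)] by blast
  have "2 \<le> length xs"
    using assms(1) by (simp add: nontrivial_gp_def)
  have active: "(p, a) \<in> active (k n) n"
    if "n \<in> set xs" "multiplicity p u \<le> multiplicity p n" for n
  proof -
    have "real a * (k n - 2) \<le> real a * real (length xs - 2)"
      using k[OF that(1)] len \<open>2 \<le> length xs\<close> by (intro mult_left_mono) auto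
    also have "\<dots> = real ((length xs - 2) * a)" by simp
    also have "\<dots> \<le> real (multiplicity p n)" using * that by linarith
    finally show ?thesis using * by (simp add: active_def)
  qed
  have deleted: "w (p, a) \<noteq> odd (multiplicity p n div a)"
    if "n \<in> set xs" "(p, a) \<in> active (k n) n" for n
  proof -
    have "n \<in> survivors k w" using that assms(2) by blast
    with that show ?thesis unfolding survivors_def by blast
  qed
  have "w (p, a) \<noteq> odd (multiplicity p u div a)" "w (p, a) \<noteq> odd (multiplicity p v div a)"
    using deleted[of u] deleted[of v] active[of u] active[of v] * by simp_all
  moreover have "multiplicity p v div a = Suc (multiplicity p u div a)"
    using * by simp
  ultimately show False by simp
qed

section \<open>Survivors in short intervals\<close>

text \<open>
  The left-hand side is the probability that no good number in the interval of length \<open>\<lfloor>x\<rfloor>\<close> at \<open>m\<close>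
  survives. The last hypothesis bounds the number of active coins of a good number by \<open>log\<^sub>2 (ln x)\<close>,
  so each good number survives with probability at least \<open>1 / ln x\<close>; there are about \<open>x / 2\<close> of
  them or more, and \<open>x \<ge> 8 * ln x * ln m\<close>.
\<close>

lemma prod_no_survivor_le:
  fixes k :: "nat \<Rightarrow> real" and x :: real
  assumes "3 \<le> m" "mono_on {1..} k" "5 < k m"
    and x: "x \<le> sqrt (real m)" "5 \<le> sqrt x" "8 * ln x \<le> sqrt x" "ln (real m) \<le> sqrt x"
    and main: "4 * ln 2 * ln (real m) \<le> (k m - 3) * ln x * ln (ln x)"
  shows "(\<Prod>n\<in>good m (nat \<lfloor>x\<rfloor>). 1 - (1 / 2) ^ card (active (k n) n)) \<le> 1 / (real m)\<^sup>2"
proof -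
  define H where "H = nat \<lfloor>x\<rfloor>"
  define y where "y = sqrt x"
  have "0 < sqrt x" using x(2) by linarith
  then have y: "5 \<le> y" "x = y\<^sup>2" "0 < x"
    using x(2) by (auto simp: y_def)
  have yy: "5 * y \<le> x"
    using y by (simp add: power2_eq_square mult_right_mono)
  have H: "real H \<le> x" "x < real H + 1"
    using y unfolding H_def by linarith+
  have "1 < ln x"
    using ln_less_cancel_iff[of "exp 1" x] exp_le y yy by auto
  have ln_x: "ln x = 2 * ln y"
    using y by (simp add: ln_realpow)
  have "0 < ln (real m)" using \<open>3 \<le> m\<close> by simp
  have card_le: "real (card (active (k n) n)) \<le> ln (ln x) / ln 2" and card_fin: "5 < k n"
    if n: "n \<in> good m H" for n
  proof -
    have n_ge: "m \<le> n" "n < m + H" using n by (auto simp: good_def)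
    have k: "k m \<le> k n"
      using assms(2) n_ge \<open>3 \<le> m\<close> by (auto simp: mono_on_def)
    then show "5 < k n" using \<open>5 < k m\<close> by simp
    have "real H \<le> real m"
    proof -
      have "sqrt (real m) \<le> real m"
        using \<open>3 \<le> m\<close> by (intro real_le_lsqrt self_le_power) auto
      with H x show ?thesis by linarith
    qed
    then have "n \<le> m * 2" using n_ge by simp
    also have "\<dots> \<le> m * m" using \<open>3 \<le> m\<close> by (intro mult_left_mono) auto
    finally have "real n \<le> (real m)\<^sup>2" by (simp add: power2_eq_square flip: of_nat_mult)
    then have "ln (real n) \<le> ln ((real m)\<^sup>2)"
      using n_ge \<open>3 \<le> m\<close> by (subst ln_le_cancel_iff) auto
    also have "\<dots> = 2 * ln (real m)"
      using \<open>3 \<le> m\<close> by (simp add: ln_realpow)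
    finally have ln_n: "ln (real n) \<le> 2 * ln (real m)" .
    define c where "c = real (card (active (k n) n))"
    have "c * (k n - 2) * ln y \<le> ln (real n)"
      unfolding c_def
    proof (rule card_active_le)
      fix p a assume "(p, a) \<in> active (k n) n"
      then have "H < 4 * p" using active_good_gt n \<open>5 < k n\<close> by blast
      then have "real H + 1 \<le> 4 * real p" by linarith
      then show "y \<le> real p" using H yy by linarith
    qed (use n_ge \<open>3 \<le> m\<close> \<open>5 < k n\<close> y in auto)
    moreover have "c * (k n - 2) * ln x = 2 * (c * (k n - 2) * ln y)"
      by (simp add: ln_x)
    ultimately have "c * (k n - 2) * ln x \<le> 4 * ln (real m)"
      using ln_n by linarith
    moreover have "c * (k m - 3) * ln x \<le> c * (k n - 2) * ln x"
      using k \<open>1 < ln x\<close> by (intro mult_right_mono mult_left_mono) (auto simp: c_def)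
    ultimately have "c * (k m - 3) * ln x * ln 2 \<le> 4 * ln (real m) * ln 2"
      by (intro mult_right_mono) auto
    also have "\<dots> \<le> (k m - 3) * ln x * ln (ln x)"
      using main by (simp add: mult_ac)
    finally have "((k m - 3) * ln x) * (c * ln 2) \<le> ((k m - 3) * ln x) * ln (ln x)"
      by (simp add: mult_ac)
    then have "c * ln 2 \<le> ln (ln x)"
      using \<open>5 < k m\<close> \<open>1 < ln x\<close> by (subst (asm) mult_le_cancel_left_pos) auto
    then show "real (card (active (k n) n)) \<le> ln (ln x) / ln 2"
      by (simp add: c_def field_simps)
  qed
  have term_le: "1 - (1 / 2) ^ card (active (k n) n) \<le> exp (- (1 / ln x))"
    if n: "n \<in> good m H" for n
  proof -
    have "2 powr real (card (active (k n) n)) \<le> 2 powr (ln (ln x) / ln 2)"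
      using card_le[OF n] by simp
    also have "\<dots> = ln x"
      using \<open>1 < ln x\<close> by (simp add: powr_def)
    finally have "2 ^ card (active (k n) n) \<le> ln x"
      by (simp add: powr_realpow)
    then have "1 / ln x \<le> (1 / 2) ^ card (active (k n) n)"
      using \<open>1 < ln x\<close> by (simp add: power_one_over frac_le)
    moreover have "1 - 1 / ln x \<le> exp (- (1 / ln x))"
      using exp_ge_add_one_self[of "- (1 / ln x)"] by simp
    ultimately show ?thesis by linarith
  qed
  have "(\<Prod>n\<in>good m H. 1 - (1 / 2) ^ card (active (k n) n))
      \<le> (\<Prod>n\<in>good m H. exp (- (1 / ln x)))"
    using term_le by (intro prod_mono) (auto simp: power_le_one)
  also have "\<dots> = exp (- (real (card (good m H)) / ln x))"
    by (simp flip: exp_of_nat_mult)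
  also have "\<dots> \<le> exp (- (2 * ln (real m)))"
  proof -
    have "8 * ln x * ln (real m) \<le> y * y"
      using x(3,4) \<open>5 \<le> y\<close> \<open>0 < ln (real m)\<close>
      by (intro mult_mono) (auto simp flip: y_def)
    also have "y * y = x" using y(2) by (simp only: power2_eq_square)
    finally have "2 * ln (real m) * ln x \<le> x / 4" by (simp add: mult_ac)
    also have "\<dots> \<le> real H / 2" using H y yy by linarith
    also have "\<dots> \<le> real (card (good m H))" by (rule card_good_ge)
    finally show ?thesis
      using \<open>1 < ln x\<close> by (simp add: field_simps)
  qed
  also have "\<dots> = 1 / (real m)\<^sup>2"
    using \<open>3 \<le> m\<close> by (simp add: exp_minus exp_double field_simps)
  finally show ?thesis by (simp add: H_def)
qed

section \<open>Consequences of the growth conditions\<close>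

lemma eventually_ln_power2_le:
  fixes h :: "nat \<Rightarrow> real"
  assumes "big_Omega h (\<lambda>n. ln (real n) powr (1 / (1 - ln 2)))"
  shows "\<forall>\<^sub>F m in sequentially. (ln (real m))\<^sup>2 \<le> h m"
proof -
  obtain C where C: "0 < C" "\<And>n. 1 \<le> n \<Longrightarrow> ln (real n) powr (1 / (1 - ln 2)) \<le> C * h n"
    using assms by (auto simp: big_Omega_def big_O_def)
  \<comment> \<open>This holds because \<open>ln 2 \<ge> 2 / 3\<close>; any exponent greater than \<open>2\<close> would do.\<close>
  have "3 \<le> 1 / (1 - ln (2 :: real))"
    using ln2_ge_two_thirds ln_2_less_1 by (simp add: field_simps)
  have "\<forall>\<^sub>F m in sequentially. C * (ln (real m))\<^sup>2 \<le> ln (real m) powr 3"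
    using \<open>0 < C\<close> by real_asymp
  moreover have "\<forall>\<^sub>F m in sequentially. 1 \<le> ln (real m)"
    by real_asymp
  ultimately show ?thesis
    using eventually_ge_at_top[of 1]
  proof eventually_elim
    case (elim m)
    note elim(1)
    also have "ln (real m) powr 3 \<le> ln (real m) powr (1 / (1 - ln 2))"
      using elim \<open>3 \<le> _\<close> by (intro powr_mono) auto
    also have "\<dots> \<le> C * h m" using C elim by simp
    finally show ?case using \<open>0 < C\<close> by simp
  qed
qed

text \<open>
  There is no upper bound on \<open>h\<close>, but an interval \<open>[m, m + x)\<close> must not reach numbers that are much
  larger than \<open>m\<close>. So \<open>h m\<close> is truncated at \<open>sqrt m\<close>. The main inequality survives this, since
  \<open>k m - 3 \<ge> 2\<close> and \<open>ln (ln (sqrt m))\<close> tends to infinity.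
\<close>

lemma eventually_truncated_conditions:
  fixes h k :: "nat \<Rightarrow> real"
  defines "x \<equiv> \<lambda>m. min (h m) (sqrt (real m))"
  assumes "big_Omega h (\<lambda>n. ln (real n) powr (1 / (1 - ln 2)))"
    and k: "\<forall>\<^sub>F n in sequentially. k n > 5"
    and main: "\<forall>\<^sub>F n in sequentially. (k n - 3) * ln (h n) * ln (ln (h n)) \<ge> 4 * ln 2 * ln (real n)"
  shows "\<forall>\<^sub>F m in sequentially. 3 \<le> m \<and> 5 < k m \<and> 5 \<le> sqrt (x m) \<and> 8 * ln (x m) \<le> sqrt (x m) \<and>
    ln (real m) \<le> sqrt (x m) \<and> 4 * ln 2 * ln (real m) \<le> (k m - 3) * ln (x m) * ln (ln (x m))"
proof -
  have sqrt: "\<forall>\<^sub>F m in sequentially. (ln (real m))\<^sup>2 \<le> sqrt (real m)"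
    by real_asymp
  have ln_x: "\<forall>\<^sub>F m in sequentially. (ln (real m))\<^sup>2 \<le> x m"
    using eventually_ln_power2_le[OF assms(2)] sqrt by eventually_elim (simp add: x_def)
  have "filterlim (\<lambda>m. (ln (real m))\<^sup>2) at_top sequentially"
    by real_asymp
  then have x_lim: "filterlim x at_top sequentially"
    using ln_x by (rule filterlim_at_top_mono)
  have "\<forall>\<^sub>F t :: real in at_top. 5 \<le> sqrt t \<and> 8 * ln t \<le> sqrt t"
    by (intro eventually_conj; real_asymp)
  then have large: "\<forall>\<^sub>F m in sequentially. 5 \<le> sqrt (x m) \<and> 8 * ln (x m) \<le> sqrt (x m)"
    using x_lim by (rule eventually_compose_filterlim)
  have trunc: "\<forall>\<^sub>F m in sequentially. 4 * ln 2 * ln (real m) \<le> 2 * ln (sqrt (real m)) * ln (ln (sqrt (real m)))"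
    by real_asymp
  have "\<forall>\<^sub>F m in sequentially. 1 \<le> ln (sqrt (real m))"
    by real_asymp
  then show ?thesis
    using k main large ln_x trunc eventually_ge_at_top[of 3]
  proof eventually_elim
    case (elim m)
    have "ln (real m) \<le> sqrt (x m)"
      using elim by (intro real_le_rsqrt)
    moreover have "4 * ln 2 * ln (real m) \<le> (k m - 3) * ln (x m) * ln (ln (x m))"
    proof (cases "h m \<le> sqrt (real m)")
      case True
      then show ?thesis using elim by (simp add: x_def)
    next
      case False
      then have x_eq: "x m = sqrt (real m)" by (simp add: x_def)
      have "4 * ln 2 * ln (real m) \<le> 2 * (ln (x m) * ln (ln (x m)))"
        using elim(6) by (simp only: x_eq mult.assoc)
      also have "\<dots> \<le> (k m - 3) * (ln (x m) * ln (ln (x m)))"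
        using elim unfolding x_eq by (intro mult_right_mono mult_nonneg_nonneg) auto
      finally show ?thesis by (simp only: mult.assoc)
    qed
    ultimately show ?case using elim by simp
  qed
qed

lemma inverse_squares_tail:
  assumes "3 \<le> m0"
  shows "summable (\<lambda>m. 1 / (real (m + m0))\<^sup>2)" "(\<Sum>m. 1 / (real (m + m0))\<^sup>2) < 1"
proof -
  define g where "g m = - (1 / (real (m + m0) - 1))" for m
  have "g \<longlonglongrightarrow> 0" unfolding g_def by real_asymp
  then have sums: "(\<lambda>m. g (Suc m) - g m) sums (0 - g 0)"
    by (rule telescope_sums)
  have le: "1 / (real (m + m0))\<^sup>2 \<le> g (Suc m) - g m" for m
  proof -
    define t where "t = real (m + m0)"
    have "3 \<le> t" using assms by (simp add: t_def)
    then have "1 / t\<^sup>2 \<le> 1 / (t - 1) - 1 / t"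
      by (simp add: field_simps power2_eq_square)
    then show ?thesis by (simp add: g_def t_def)
  qed
  show summable: "summable (\<lambda>m. 1 / (real (m + m0))\<^sup>2)"
    by (rule summable_comparison_test'[OF sums_summable[OF sums], of 0]) (use le in auto)
  have "(\<Sum>m. 1 / (real (m + m0))\<^sup>2) \<le> (\<Sum>m. g (Suc m) - g m)"
    using summable sums by (intro suminf_le le) (auto simp: sums_iff)
  also have "\<dots> = 1 / (real m0 - 1)" using sums by (simp add: sums_iff g_def)
  also have "\<dots> < 1" using assms by (simp add: field_simps)
  finally show "(\<Sum>m. 1 / (real (m + m0))\<^sup>2) < 1" .
qed

section \<open>Sequences without long progressions and with small gaps\<close>

theorem theorem4:
  fixes h k :: "nat \<Rightarrow> real"
  assumes "\<And>n. n \<ge> 1 \<Longrightarrow> h n > 0" and "mono_on {1..} h"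
    and "\<And>n. n \<ge> 1 \<Longrightarrow> k n > 0" and "mono_on {1..} k"
    and "big_Omega h (\<lambda>n. ln (real n) powr (1 / (1 - ln 2)))"
    and "\<forall>\<^sub>F n in sequentially. k n > 5"
    and "\<forall>\<^sub>F n in sequentially. (k n - 3) * ln (h n) * ln (ln (h n)) \<ge> 4 * ln 2 * ln (real n)"
  shows "\<exists>t :: nat \<Rightarrow> nat. strict_mono t \<and> (\<forall>i. t i > 0) \<and>
           gp_free k (range t) \<and> has_gaps_O h (range t)"
proof -
  define x where "x m = min (h m) (sqrt (real m))" for m
  define G where "G m = good m (nat \<lfloor>x m\<rfloor>)" for m
  define P where "P n = active (k n) n" for n
  obtain m0 where m0: "\<And>m. m0 \<le> m \<Longrightarrow>
    3 \<le> m \<and> 5 < k m \<and> 5 \<le> sqrt (x m) \<and> 8 * ln (x m) \<le> sqrt (x m) \<and>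
    ln (real m) \<le> sqrt (x m) \<and> 4 * ln 2 * ln (real m) \<le> (k m - 3) * ln (x m) * ln (ln (x m))"
    using eventually_truncated_conditions[OF assms(5-7)]
    by (auto simp: eventually_sequentially x_def)
  have "3 \<le> m0" using m0 by blast
  have G: "m \<le> n" "real n < real m + h m" if "n \<in> G m" "m0 \<le> m" for m n
  proof -
    show "m \<le> n" using that by (auto simp: G_def good_def)
    have "0 < sqrt (x m)" using m0[OF that(2)] by linarith
    then have "0 \<le> x m" by simp
    then have "real (nat \<lfloor>x m\<rfloor>) \<le> x m" by linarith
    moreover have "n < m + nat \<lfloor>x m\<rfloor>" using that by (auto simp: G_def good_def)
    then have "real n < real m + real (nat \<lfloor>x m\<rfloor>)" by linarith
    moreover have "x m \<le> h m" by (simp add: x_def)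
    ultimately show "real n < real m + h m" by linarith
  qed
  obtain w where w: "\<And>m. \<exists>n\<in>G (m + m0). \<forall>c\<in>P n. w c \<noteq> (case c of (p, a) \<Rightarrow> odd (multiplicity p n div a))"
  proof -
    have "\<exists>w. \<forall>m. \<exists>n\<in>G (m + m0). \<forall>c\<in>P n. w c \<noteq> (case c of (p, a) \<Rightarrow> odd (multiplicity p n div a))"
    proof (rule exists_coins_with_survivors)
      fix m
      show "finite (G (m + m0))" by (simp add: G_def good_def)
      show "finite (P n)" if "n \<in> G (m + m0)" for n
        unfolding P_def using G[OF that] m0[of n] by (intro finite_active) auto
      show "disjoint_family_on P (G (m + m0))"
        unfolding P_def G_def
      proof (rule active_good_disjoint)
        fix n assume "n \<in> good (m + m0) (nat \<lfloor>x (m + m0)\<rfloor>)"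
        then have "m0 \<le> n" using G(1)[of n "m + m0"] by (simp add: G_def)
        then show "5 < k n" using m0 by blast
      qed
      show "(\<Prod>n\<in>G (m + m0). 1 - (1 / 2) ^ card (P n)) \<le> 1 / (real (m + m0))\<^sup>2"
        unfolding P_def G_def using m0[of "m + m0"] assms(4)
        by (intro prod_no_survivor_le) (auto simp: x_def)
    qed (use inverse_squares_tail[OF \<open>3 \<le> m0\<close>] in auto)
    then show ?thesis using that by blast
  qed
  \<comment> \<open>Discarding the numbers below \<open>m0\<close> ensures \<open>k N > 5\<close> wherever it matters, and costs only a
    constant factor in the gaps.\<close>
  define T where "T = survivors k w \<inter> {m0..}"
  have hit: "\<exists>s\<in>T. m \<le> s \<and> real s < real m + h m" if "m0 \<le> m" for m
  proof -
    obtain n where "n \<in> G m" "\<forall>c\<in>P n. w c \<noteq> (case c of (p, a) \<Rightarrow> odd (multiplicity p n div a))"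
      using w[of "m - m0"] \<open>m0 \<le> m\<close> by auto
    then show ?thesis
      using G[of n m] \<open>m0 \<le> m\<close> by (intro bexI[of _ n]) (auto simp: T_def survivors_def P_def)
  qed
  have "infinite T"
    unfolding infinite_nat_iff_unbounded_le
  proof
    fix m
    show "\<exists>n\<ge>m. n \<in> T"
      using hit[of "max m m0"] by auto
  qed
  then obtain t :: "nat \<Rightarrow> nat" where t: "strict_mono t" "range t = T"
    using strict_mono_enumerate range_enumerate by blast
  have "gp_free k T"
    unfolding gp_free_def
  proof (intro allI impI notI, elim exE conjE)
    fix N xs
    assume xs: "nontrivial_gp xs" "set xs \<subseteq> T \<inter> {1..N}" "k N \<le> real (length xs)"
    have "real (length xs) < k N"
    proof (rule gp_length_lt_of_survivors[OF xs(1)])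
      show "set xs \<subseteq> survivors k w" using xs by (auto simp: T_def)
      show "k n \<le> k N" if "n \<in> set xs" for n
        using xs that assms(4) by (intro mono_onD[of "{1..}" k]) auto
    qed
    with xs show False by simp
  qed
  moreover have "has_gaps_O h T"
    unfolding has_gaps_O_def
    \<comment> \<open>The second summand of the constant accounts for starting points \<open>m < m0\<close>.\<close>
  proof (intro exI[of _ "1 + (real m0 + h m0) / h 1"] conjI allI impI)
    have h: "0 < h 1" "0 < h m0" using assms(1) \<open>3 \<le> m0\<close> by auto
    then show "0 < 1 + (real m0 + h m0) / h 1" by (simp add: add_pos_nonneg)
    fix m N :: nat
    assume mN: "1 \<le> m \<and> m \<le> N"
    have mono: "h i \<le> h N" if "1 \<le> i" "i \<le> N" for i
      using assms(2) that by (auto simp: mono_on_def)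
    have expand: "(1 + (real m0 + h m0) / h 1) * h N = h N + (real m0 + h m0) * (h N / h 1)"
      by (simp add: algebra_simps)
    have hN: "1 \<le> h N / h 1" "0 < h N" using mono[of 1] mN h assms(1)[of N] by auto
    have prod: "real m0 + h m0 \<le> (real m0 + h m0) * (h N / h 1)"
      using mult_left_mono[OF hN(1), of "real m0 + h m0"] h by simp
    show "\<exists>s\<in>T. real s \<in> {real m..<real m + (1 + (real m0 + h m0) / h 1) * h N}"
    proof (cases "m0 \<le> m")
      case True
      then obtain s where "s \<in> T" "m \<le> s" "real s < real m + h m"
        using hit[of m] by auto
      then show ?thesis
        using mono[of m] mN expand prod h by (intro bexI[of _ s]) auto
    next
      case False
      then obtain s where "s \<in> T" "m0 \<le> s" "real s < real m0 + h m0"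
        using hit[of m0] by auto
      then show ?thesis
        using False expand prod hN by (intro bexI[of _ s]) auto
    qed
  qed
  moreover have "0 < t i" for i
  proof -
    have "t i \<in> T" using t by blast
    then show ?thesis using \<open>3 \<le> m0\<close> by (simp add: T_def)
  qed
  ultimately show ?thesis
    using t by auto
qed

end
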